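(* Let $\Sigma$ be a finite set, let $p\in\Delta(\Sigma)$ have full support, let $G=(G_u)_{u\in\Sigma}$ be a random vector with support $\mathbb{G}\subseteq\mathbb{R}^{\Sigma}$ and i.i.d. standard Gumbel coordinates, and let $\delta>0$. Let $$q^*\in\arg\max_{q:\mathbb{G}\to\Delta(\Sigma)}\ \Big(\mathbb{E}\big[G\cdot q(G)\big]-\frac1\delta\,\mathrm{KL}\big(\mathbb{E}[q(G)]\,\|\,p\big)\Big),$$ the maximum being over measurable maps $q:\mathbb{G}\to\Delta(\Sigma)$. Then, almost surely, $$\forall u\in\Sigma,\qquad q^*(G)_u=\mathbf{1}\Big\{u\in\arg\max_{v\in\Sigma}\Big(G_v+\frac{1}{1+\delta}\log p_v\Big)\Big\}.$$
   Context: $\Delta(\Sigma)$ is the set of probability vectors on the finite set $\Sigma$; full support means $p_u>0$ for all $u$. The dot product is $g\cdot q=\sum_{u\in\Sigma}g_uq_u$. $\mathrm{KL}(r\|p)=\sum_{u\in\Sigma}r_u\log\frac{r_u}{p_u}$ with the convention $0\log0=0$. The expectation $\mathbb{E}[q(G)]\in\Delta(\Sigma)$ is coordinatewise. The standard Gumbel law has distribution function $x\mapsto e^{-e^{-x}}$; the argmax is almost surely a single index. *)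

theory Defs
  imports "HOL-Probability.Probability"
begin

text \<open>The finite set \<open>\<Sigma>\<close> is the (arbitrary) finite index type \<open>'s\<close>; vectors in
  \<open>\<real>\<^sup>\<Sigma>\<close> have type \<^typ>\<open>real ^ 's\<close>, whose inner product is the dot product.\<close>

definition prob_simplex :: "(real ^ 's::finite) set" where
  "prob_simplex = {q. (\<forall>u. 0 \<le> q $ u) \<and> (\<Sum>u\<in>UNIV. q $ u) = 1}"

text \<open>The logarithm is natural; \<open>0 log 0 = 0\<close> holds automatically since the term is multiplied
  by \<open>r $ u = 0\<close>.\<close>

definition KL :: "real ^ 's::finite \<Rightarrow> real ^ 's \<Rightarrow> real" where
  "KL r p = (\<Sum>u\<in>UNIV. r $ u * ln (r $ u / p $ u))"

definition standard_gumbel :: "'w measure \<Rightarrow> ('w \<Rightarrow> real) \<Rightarrow> bool" where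
  "standard_gumbel M X \<longleftrightarrow>
     X \<in> borel_measurable M \<and> (\<forall>x. cdf (distr M borel X) x = exp (- exp (- x)))"

definition iid_standard_gumbel :: "'w measure \<Rightarrow> ('w \<Rightarrow> real ^ 's::finite) \<Rightarrow> bool" where
  "iid_standard_gumbel M G \<longleftrightarrow>
     G \<in> borel_measurable M \<and>
     prob_space.indep_vars M (\<lambda>_. borel) (\<lambda>u \<omega>. G \<omega> $ u) UNIV \<and>
     (\<forall>u. standard_gumbel M (\<lambda>\<omega>. G \<omega> $ u))"

definition law_support :: "'w measure \<Rightarrow> ('w \<Rightarrow> 'a::topological_space) \<Rightarrow> 'a set" where
  "law_support M X = {x. \<forall>U. open U \<longrightarrow> x \<in> U \<longrightarrow> measure (distr M borel X) U > 0}"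

text \<open>Maps from the support to the simplex are represented by total functions; only their
  restriction to \<open>law_support M G\<close> is constrained. The random vector lies in its support almost
  surely, so the values elsewhere are irrelevant (the support of i.i.d. Gumbel coordinates is in
  fact the whole space).\<close>

definition selection_maps ::
    "'w measure \<Rightarrow> ('w \<Rightarrow> real ^ 's::finite) \<Rightarrow> (real ^ 's \<Rightarrow> real ^ 's) set" where
  "selection_maps M G =
     restrict_space borel (law_support M G) \<rightarrow>\<^sub>M restrict_space borel prob_simplex"

definition mean_vec :: "'w measure \<Rightarrow> ('w \<Rightarrow> real ^ 's::finite) \<Rightarrow> real ^ 's" where
  "mean_vec M Y = (\<chi> u. \<integral>\<omega>. Y \<omega> $ u \<partial>M)"

definition KL_objective ::
    "'w measure \<Rightarrow> ('w \<Rightarrow> real ^ 's::finite) \<Rightarrow> real ^ 's \<Rightarrow> real \<Rightarrow> (real ^ 's \<Rightarrow> real ^ 's) \<Rightarrow> real" where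
  "KL_objective M G p \<delta> q =
     (\<integral>\<omega>. G \<omega> \<bullet> q (G \<omega>) \<partial>M) - 1 / \<delta> * KL (mean_vec M (\<lambda>\<omega>. q (G \<omega>))) p"

end

theory Submission
  imports Defs
begin

text \<open>Put \<open>b = log p / (1 + \<delta>)\<close>. Since \<open>log p = (1 + \<delta>) b\<close>, the objective at \<open>q\<close> with mean \<open>r\<close> equals
  \<open>E[(G + b) \<bullet> q(G)] - (KL(r \<parallel> softmax b) - log (\<Sum>v. exp (b v))) / \<delta>\<close>.
  The selector of the argmax of \<open>G + b\<close> maximises the first term pointwise, and it also
  minimises the divergence, because its mean is \<open>softmax b\<close>: the variables \<open>exp (- (G u + b u))\<close>
  are independent exponentials with rates \<open>exp (b u)\<close>, and \<open>u\<close> wins when its variable comes first.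
  Hence any other optimal \<open>q\<close> attains the pointwise maximum almost surely. The winning
  probabilities sum to 1, so the argmax is almost surely unique, which determines \<open>q\<close>.\<close>

section \<open>Integrability of Gumbel variables\<close>

text \<open>The number of naturals \<open>n\<close> with \<open>n < \<bar>X\<bar>\<close> is at
  least \<open>\<bar>X\<bar>\<close>, so summing the tail probabilities bounds the expectation of
  \<open>\<bar>X\<bar>\<close>.\<close>

lemma (in prob_space) integrable_if_summable_tails:
  fixes X :: "'a \<Rightarrow> real"
  assumes [measurable]: "X \<in> borel_measurable M"
    and "summable (\<lambda>n. prob {\<omega> \<in> space M. real n < \<bar>X \<omega>\<bar>})"
  shows "integrable M X"
proof (rule integrableI_bounded)
  have "ennreal (norm (X \<omega>)) \<le> (\<Sum>n. indicator {\<omega> \<in> space M. real n < \<bar>X \<omega>\<bar>} \<omega>)"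
    if "\<omega> \<in> space M" for \<omega>
  proof -
    \<comment> \<open>With the ceiling, every \<open>n < k\<close> still satisfies the strict bound
      \<open>n < \<bar>X \<omega>\<bar>\<close>, so the first \<open>k\<close> indicators are all
      1.\<close>
    define k where "k = nat \<lceil>\<bar>X \<omega>\<bar>\<rceil>"
    have "norm (X \<omega>) \<le> real k" unfolding k_def by simp
    then have "ennreal (norm (X \<omega>)) \<le> of_nat k"
      by (metis ennreal_leI ennreal_of_nat_eq_real_of_nat)
    also have "of_nat k = (\<Sum>n<k. indicator {\<omega> \<in> space M. real n < \<bar>X \<omega>\<bar>} \<omega> :: ennreal)"
    proof -
      have "real n < \<bar>X \<omega>\<bar>" if "n < k" for n
        using that unfolding k_def by linarith
      then show ?thesis using that by simp
    qed
    also have "\<dots> \<le> (\<Sum>n. indicator {\<omega> \<in> space M. real n < \<bar>X \<omega>\<bar>} \<omega>)"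
      by (intro sum_le_suminf) auto
    finally show ?thesis .
  qed
  then have "(\<integral>\<^sup>+\<omega>. ennreal (norm (X \<omega>)) \<partial>M)
      \<le> (\<integral>\<^sup>+\<omega>. (\<Sum>n. indicator {\<omega> \<in> space M. real n < \<bar>X \<omega>\<bar>} \<omega>) \<partial>M)"
    by (intro nn_integral_mono)
  also have "\<dots> = (\<Sum>n. ennreal (prob {\<omega> \<in> space M. real n < \<bar>X \<omega>\<bar>}))"
    by (simp add: nn_integral_suminf emeasure_eq_measure)
  also have "\<dots> < \<infinity>"
    using assms(2) by (simp add: suminf_ennreal_eq[OF _ summable_sums])
  finally show "(\<integral>\<^sup>+\<omega>. ennreal (norm (X \<omega>)) \<partial>M) < \<infinity>" .
qed simp

lemma (in prob_space) standard_gumbel_cdf: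
  assumes "standard_gumbel M X"
  shows "prob {\<omega> \<in> space M. X \<omega> \<le> x} = exp (- exp (- x))"
proof -
  have [measurable]: "X \<in> borel_measurable M"
    and "cdf (distr M borel X) x = exp (- exp (- x))"
    using assms by (auto simp: standard_gumbel_def)
  moreover have "X -` {..x} \<inter> space M = {\<omega> \<in> space M. X \<omega> \<le> x}" by auto
  ultimately show ?thesis by (simp add: cdf_def measure_distr)
qed

text \<open>Both tails are at most \<open>exp (- x)\<close>, which is summable over the naturals.
  Integrability is what later allows the expected reward to be split into its terms.\<close>

lemma (in prob_space) standard_gumbel_integrable:
  assumes "standard_gumbel M X"
  shows "integrable M X"
proof (rule integrable_if_summable_tails)
  show [measurable]: "X \<in> borel_measurable M"
    using assms by (simp add: standard_gumbel_def)
  have tail: "prob {\<omega> \<in> space M. x < \<bar>X \<omega>\<bar>} \<le> 2 * exp (- x)" if "0 \<le> x" for x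
  proof -
    have "prob {\<omega> \<in> space M. x < \<bar>X \<omega>\<bar>}
        \<le> prob ((space M - {\<omega> \<in> space M. X \<omega> \<le> x}) \<union> {\<omega> \<in> space M. X \<omega> \<le> - x})"
      by (rule finite_measure_mono) auto
    also have "\<dots> \<le> prob (space M - {\<omega> \<in> space M. X \<omega> \<le> x}) + prob {\<omega> \<in> space M. X \<omega> \<le> - x}"
      by (rule measure_Un_le) auto
    also have "\<dots> = (1 - exp (- exp (- x))) + exp (- exp x)"
      by (simp add: prob_compl standard_gumbel_cdf[OF assms])
    \<comment> \<open>Right tail: \<open>1 + y \<le> exp y\<close> at
      \<open>y = - exp (- x)\<close>. The left tail below uses \<open>x \<le> exp x\<close>.\<close>
    also have "1 - exp (- exp (- x)) \<le> exp (- x)"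
      using exp_ge_add_one_self[of "- exp (- x)"] by linarith
    also have "exp (- exp x) \<le> exp (- x)"
      using exp_ge_add_one_self[of x] by (subst exp_le_cancel_iff) linarith
    finally show ?thesis by simp
  qed
  have "summable (\<lambda>n. 2 * exp (- 1 :: real) ^ n)"
    by (intro summable_mult summable_geometric) simp
  then show "summable (\<lambda>n. prob {\<omega> \<in> space M. real n < \<bar>X \<omega>\<bar>})"
  proof (rule summable_comparison_test')
    fix n :: nat
    have "exp (- real n) = exp (- 1) ^ n"
      using exp_of_nat_mult[of n "- 1 :: real"] by simp
    then show "norm (prob {\<omega> \<in> space M. real n < \<bar>X \<omega>\<bar>}) \<le> 2 * exp (- 1) ^ n"
      using tail[of "real n"] by (simp only: real_norm_def abs_of_nonneg measure_nonneg of_nat_0_le_iff)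
  qed
qed

section \<open>Races between independent exponential variables\<close>

text \<open>By Fubini, the probability is the integral of the tail \<open>exp (- x * u)\<close> of
  \<open>Y\<close> against the density of \<open>X\<close>. The integrand is
  \<open>l / (l + u)\<close> times the exponential density of rate \<open>l + u\<close>, whose total
  mass is 1.\<close>

lemma (in prob_space) exponential_distributed_less:
  assumes l: "0 < l" and u: "0 < u"
    and X: "distributed M lborel X (exponential_density l)"
    and Y: "distributed M lborel Y (exponential_density u)"
    and ind: "indep_var borel X borel Y"
  shows "prob {\<omega> \<in> space M. X \<omega> < Y \<omega>} = l / (l + u)"
proof -
  have [measurable]: "X \<in> borel_measurable M" "Y \<in> borel_measurable M"
    using X Y l u by (simp_all add: exponential_distributed_iff)
  interpret Y: prob_space "distr M borel Y" by (rule prob_space_distr) simp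
  have dX: "distr M borel X = density lborel (exponential_density l)"
    using X by (simp add: distributed_def cong: distr_cong)
  have tail: "emeasure (distr M borel Y) {x<..} = exp (- x * u)" if "0 \<le> x" for x
  proof -
    have "Y -` {x<..} \<inter> space M = {\<omega> \<in> space M. x < Y \<omega>}" by auto
    then show ?thesis
      using exponential_distributedD_gt[OF Y that u] by (simp add: emeasure_distr emeasure_eq_measure)
  qed
  \<comment> \<open>The section of this set at \<open>x\<close> is \<open>{x<..}\<close>, so its
    measurability serves both Fubini and the measurability of the tail as a function of
    \<open>x\<close>.\<close>
  have "{z \<in> space (borel \<Otimes>\<^sub>M borel). fst z < snd z} \<in> sets (borel \<Otimes>\<^sub>M (borel :: real measure))"
    by measurable
  then have less: "{z :: real \<times> real. fst z < snd z} \<in> sets (borel \<Otimes>\<^sub>M borel)"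
    by (simp add: space_pair_measure)
  have "(\<lambda>x. emeasure (distr M borel Y) (Pair x -` {z. fst z < snd z})) \<in> borel_measurable borel"
    using less by (intro Y.measurable_emeasure_Pair) (simp cong: sets_pair_measure_cong)
  then have tail_measurable: "(\<lambda>x. emeasure (distr M borel Y) {x<..}) \<in> borel_measurable borel"
    by (simp add: vimage_def greaterThan_def)
  have "emeasure M {\<omega> \<in> space M. X \<omega> < Y \<omega>}
      = emeasure (distr M (borel \<Otimes>\<^sub>M borel) (\<lambda>\<omega>. (X \<omega>, Y \<omega>))) {z. fst z < snd z}"
    by (subst emeasure_distr) (auto intro!: arg_cong[where f = "emeasure M"] less)
  also have "\<dots> = emeasure (distr M borel X \<Otimes>\<^sub>M distr M borel Y) {z. fst z < snd z}"
    using ind by (simp add: indep_var_distribution_eq)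
  also have "\<dots> = (\<integral>\<^sup>+x. emeasure (distr M borel Y) (Pair x -` {z. fst z < snd z}) \<partial>distr M borel X)"
  proof (rule Y.emeasure_pair_measure_alt)
    have "sets (distr M borel X \<Otimes>\<^sub>M distr M borel Y) = sets (borel \<Otimes>\<^sub>M borel)"
      by (intro sets_pair_measure_cong) auto
    with less show "{z. fst z < snd z} \<in> sets (distr M borel X \<Otimes>\<^sub>M distr M borel Y)" by simp
  qed
  also have "\<dots> = (\<integral>\<^sup>+x. emeasure (distr M borel Y) {x<..} \<partial>distr M borel X)"
    by (simp add: vimage_def greaterThan_def)
  also have "\<dots> = (\<integral>\<^sup>+x. exponential_density l x * emeasure (distr M borel Y) {x<..} \<partial>lborel)"
    unfolding dX by (subst nn_integral_density) (auto simp: tail_measurable)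
  also have "\<dots> = (\<integral>\<^sup>+x. ennreal (l / (l + u)) * ennreal (exponential_density (l + u) x) \<partial>lborel)"
  proof (rule nn_integral_cong)
    fix x :: real
    show "ennreal (exponential_density l x) * emeasure (distr M borel Y) {x<..}
        = ennreal (l / (l + u)) * ennreal (exponential_density (l + u) x)"
    proof (cases "x < 0")
      case False
      have "exp (- x * l) * exp (- x * u) = exp (- x * (l + u))"
        by (simp add: mult_exp_exp algebra_simps)
      then have "exponential_density l x * exp (- x * u) = l / (l + u) * exponential_density (l + u) x"
        using False l u by (simp add: exponential_density_def)
      with False l u show ?thesis
        by (simp add: tail ennreal_mult[symmetric] exponential_density_nonneg)
    qed (simp add: exponential_density_def)
  qed
  also have "\<dots> = ennreal (l / (l + u)) * emeasure (density lborel (exponential_density (l + u))) UNIV"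
    by (simp add: nn_integral_cmult emeasure_density)
  also have "\<dots> = ennreal (l / (l + u))"
    using prob_space.emeasure_space_1[OF prob_space_exponential_density[of "l + u"]] l u by simp
  finally show ?thesis
    using l u by (simp add: emeasure_eq_measure)
qed

text \<open>The minimum of the rivals of \<open>i\<close> is exponential with the sum of their rates
  and independent of \<open>T i\<close>, so the race reduces to two runners.\<close>

lemma (in prob_space) exponential_race:
  fixes T :: "'i \<Rightarrow> 'a \<Rightarrow> real"
  assumes I: "finite I" "i \<in> I" and l: "\<And>j. j \<in> I \<Longrightarrow> 0 < l j"
    and T: "\<And>j. j \<in> I \<Longrightarrow> distributed M lborel (T j) (exponential_density (l j))"
    and ind: "indep_vars (\<lambda>_. borel) T I"
  shows "prob {\<omega> \<in> space M. \<forall>j\<in>I - {i}. T i \<omega> < T j \<omega>} = l i / (\<Sum>j\<in>I. l j)"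
proof (cases "I = {i}")
  \<comment> \<open>Without rivals the minimum below would range over the empty set; here the event
    is the whole space.\<close>
  case True
  then show ?thesis using l[of i] by (simp add: prob_space)
next
  case False
  define J where "J = I - {i}"
  have J: "finite J" "J \<noteq> {}" "I = insert i J" "i \<notin> J" using I False by (auto simp: J_def)
  have "prob {\<omega> \<in> space M. \<forall>j\<in>J. T i \<omega> < T j \<omega>}
      = prob {\<omega> \<in> space M. T i \<omega> < Min ((\<lambda>j. T j \<omega>) ` J)}"
    using J by simp
  also have "\<dots> = l i / (l i + (\<Sum>j\<in>J. l j))"
  proof (rule exponential_distributed_less)
    show "distributed M lborel (\<lambda>\<omega>. Min ((\<lambda>j. T j \<omega>) ` J)) (exponential_density (\<Sum>j\<in>J. l j))"
      by (rule exponential_distributed_Min) (use J l T ind in \<open>auto intro: indep_vars_subset\<close>)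
    show "indep_var borel (T i) borel (\<lambda>\<omega>. Min ((\<lambda>j. T j \<omega>) ` J))"
      by (rule indep_vars_Min) (use J ind in auto)
  qed (use J l T in \<open>auto intro: sum_pos\<close>)
  also have "l i + (\<Sum>j\<in>J. l j) = (\<Sum>j\<in>I. l j)"
    unfolding J_def using I by (simp add: sum.remove[of I i])
  finally show ?thesis by (simp only: J_def)
qed

section \<open>Gumbel vectors: measurability, exponential transform, support\<close>

lemma borel_measurable_vec_nth [measurable (raw)]:
  fixes f :: "'a \<Rightarrow> real ^ 's::finite"
  assumes "f \<in> borel_measurable N"
  shows "(\<lambda>x. f x $ u) \<in> borel_measurable N"
  by (rule measurable_compose[OF assms])
    (intro borel_measurable_continuous_onI continuous_intros)

lemma borel_measurable_vec_lambda:
  fixes f :: "'s::finite \<Rightarrow> 'a \<Rightarrow> real"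
  assumes [measurable]: "\<And>u. f u \<in> borel_measurable N"
  shows "(\<lambda>x. \<chi> u. f u x) \<in> borel_measurable N"
proof -
  have "(\<chi> u. f u x) = (\<Sum>u\<in>UNIV. f u x *\<^sub>R axis u 1)" for x
    by (subst basis_expansion[symmetric]) (simp add: scalar_mult_eq_scaleR)
  then show ?thesis by simp
qed

text \<open>The probability of \<open>X < x\<close> is the left limit of the distribution function,
  which is continuous. The strict form is needed because \<open>exp (- X)\<close> reverses the
  order.\<close>

lemma (in prob_space) standard_gumbel_cdf_strict:
  assumes "standard_gumbel M X"
  shows "prob {\<omega> \<in> space M. X \<omega> < x} = exp (- exp (- x))"
proof -
  have [measurable]: "X \<in> borel_measurable M"
    and F: "cdf (distr M borel X) = (\<lambda>x. exp (- exp (- x)))"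
    using assms by (auto simp: standard_gumbel_def)
  interpret D: real_distribution "distr M borel X" by (rule real_distribution_distr) simp
  have "(cdf (distr M borel X) \<longlongrightarrow> exp (- exp (- x))) (at_left x)"
    unfolding F by (intro tendsto_intros)
  then have "measure (distr M borel X) {..<x} = exp (- exp (- x))"
    by (rule tendsto_unique[OF _ D.cdf_at_left, rotated]) simp
  moreover have "X -` {..<x} \<inter> space M = {\<omega> \<in> space M. X \<omega> < x}" by auto
  ultimately show ?thesis by (simp add: measure_distr)
qed

text \<open>For \<open>a > 0\<close>, \<open>exp (- (X + b)) \<le> a\<close> means
  \<open>X \<ge> - (ln a + b)\<close>, and the Gumbel law gives this event probability
  \<open>1 - exp (- exp (ln a + b)) = 1 - exp (- a * exp b)\<close>.\<close>

lemma (in prob_space) standard_gumbel_exponential: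
  assumes "standard_gumbel M X"
  shows "distributed M lborel (\<lambda>\<omega>. exp (- (X \<omega> + b))) (exponential_density (exp b))"
proof -
  have [measurable]: "X \<in> borel_measurable M"
    using assms by (simp add: standard_gumbel_def)
  have "prob {\<omega> \<in> space M. exp (- (X \<omega> + b)) \<le> a} = 1 - exp (- a * exp b)" if "0 \<le> a" for a
  \<comment> \<open>At \<open>a = 0\<close> the logarithm carries no information, but the event is
    empty and both sides are 0.\<close>
  proof (cases "a = 0")
    case False
    with that have a: "0 < a" by simp
    have "exp (- (X \<omega> + b)) \<le> a \<longleftrightarrow> \<not> X \<omega> < - (ln a + b)" for \<omega>
    proof -
      have "exp (- (X \<omega> + b)) \<le> a \<longleftrightarrow> - (X \<omega> + b) \<le> ln a"
        using a by (metis exp_le_cancel_iff exp_ln)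
      then show ?thesis by linarith
    qed
    then have "{\<omega> \<in> space M. exp (- (X \<omega> + b)) \<le> a}
        = space M - {\<omega> \<in> space M. X \<omega> < - (ln a + b)}" by auto
    then show ?thesis
      using a by (simp add: prob_compl standard_gumbel_cdf_strict[OF assms] exp_add)
  qed (simp add: not_le)
  then show ?thesis by (simp add: exponential_distributed_iff)
qed

text \<open>Every open neighbourhood contains a box, whose probability is by independence a product
  of interval probabilities, each positive because the Gumbel distribution function is strictly
  increasing.\<close>

lemma (in prob_space) law_support_gumbel:
  fixes G :: "'a \<Rightarrow> real ^ 's::finite"
  assumes "iid_standard_gumbel M G"
  shows "law_support M G = UNIV"
proof -
  have G [measurable]: "G \<in> borel_measurable M"
    and ind: "indep_vars (\<lambda>_. borel) (\<lambda>u \<omega>. G \<omega> $ u) UNIV"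
    and gum: "\<And>u. standard_gumbel M (\<lambda>\<omega>. G \<omega> $ u)"
    using assms by (auto simp: iid_standard_gumbel_def)
  have "0 < measure (distr M borel G) U" if U: "open U" "x \<in> U" for U x
  proof -
    obtain a b where ab: "cbox a b \<subseteq> U" "x \<in> box a b"
      using open_contains_cbox[OF U] by metis
    have lt: "a $ u < b $ u" for u
      using ab(2) by (metis mem_box_cart(1) less_trans)
    \<comment> \<open>Half-open intervals make each probability an exact difference of two values of
      the distribution function.\<close>
    define A where "A u = (\<lambda>\<omega>. G \<omega> $ u) -` {a $ u<..b $ u} \<inter> space M" for u
    have pos: "0 < prob (A u)" for u
    proof -
      have "A u = {\<omega> \<in> space M. G \<omega> $ u \<le> b $ u} - {\<omega> \<in> space M. G \<omega> $ u \<le> a $ u}"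
        by (auto simp: A_def)
      moreover have "prob \<dots> = exp (- exp (- b $ u)) - exp (- exp (- a $ u))"
        using lt[of u]
        by (subst finite_measure_Diff) (auto simp: standard_gumbel_cdf[OF gum])
      ultimately show ?thesis using lt[of u] by simp
    qed
    have "0 < (\<Prod>u\<in>UNIV. prob (A u))"
      using pos by (intro prod_pos) simp
    also have "\<dots> = prob (\<Inter>u\<in>UNIV. A u)"
      unfolding A_def by (rule indep_varsD_finite[OF ind, symmetric]) auto
    also have "\<dots> \<le> prob (G -` U \<inter> space M)"
    proof (rule finite_measure_mono)
      show "(\<Inter>u\<in>UNIV. A u) \<subseteq> G -` U \<inter> space M"
      proof
        fix \<omega> assume "\<omega> \<in> (\<Inter>u\<in>UNIV. A u)"
        then have "\<omega> \<in> space M" "\<And>u. a $ u < G \<omega> $ u" "\<And>u. G \<omega> $ u \<le> b $ u"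
          by (auto simp: A_def)
        then have "G \<omega> \<in> cbox a b"
          by (simp add: mem_box_cart less_imp_le)
        with ab(1) \<open>\<omega> \<in> space M\<close> show "\<omega> \<in> G -` U \<inter> space M" by auto
      qed
      show "G -` U \<inter> space M \<in> events" using U by measurable
    qed
    also have "\<dots> = measure (distr M borel G) U"
      using U by (simp add: measure_distr)
    finally show ?thesis .
  qed
  then show ?thesis by (auto simp: law_support_def)
qed

section \<open>The Gumbel-max law and almost sure uniqueness of the argmax\<close>

text \<open>Strictness makes the winner unique and the winning events of different indices disjoint;
  under a tie for the maximum no index qualifies.\<close>

definition strict_argmax :: "('i \<Rightarrow> real) \<Rightarrow> 'i \<Rightarrow> bool" where
  "strict_argmax f u \<longleftrightarrow> (\<forall>v. v \<noteq> u \<longrightarrow> f v < f u)"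

lemma strict_argmax_unique: "strict_argmax f u \<Longrightarrow> strict_argmax f v \<Longrightarrow> u = v"
  unfolding strict_argmax_def by (metis less_asym)

lemma is_arg_max_iff_strict_argmax:
  "strict_argmax f w \<Longrightarrow> is_arg_max f (\<lambda>v. True) u \<longleftrightarrow> u = w"
  unfolding strict_argmax_def is_arg_max_def by (metis less_asym less_irrefl)

definition softmax :: "('s::finite \<Rightarrow> real) \<Rightarrow> real ^ 's" where
  "softmax b = (\<chi> u. exp (b u) / (\<Sum>v\<in>UNIV. exp (b v)))"

lemma sum_exp_pos: "0 < (\<Sum>v\<in>UNIV. exp (b v :: real))" for b :: "'s::finite \<Rightarrow> real"
  by (rule sum_pos) auto

lemma softmax_pos: "0 < softmax b $ u"
  by (simp add: softmax_def sum_exp_pos)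

lemma softmax_simplex: "softmax b \<in> prob_simplex"
proof -
  have "(\<Sum>u\<in>UNIV. softmax b $ u) = 1"
    using sum_exp_pos[of b] by (simp add: softmax_def flip: sum_divide_distrib)
  then show ?thesis
    by (simp add: prob_simplex_def less_imp_le[OF softmax_pos])
qed

lemma measurable_strict_argmax [measurable]:
  fixes b :: "'s::finite \<Rightarrow> real"
  shows "Measurable.pred borel (\<lambda>x :: real ^ 's. strict_argmax (\<lambda>v. x $ v + b v) u)"
  unfolding strict_argmax_def by measurable

text \<open>The map \<open>x \<mapsto> exp (- x)\<close> is decreasing, so \<open>u\<close> is the
  strict argmax exactly when its exponential variable, of rate \<open>exp (b u)\<close>, comes first
  in the race.\<close>

lemma (in prob_space) gumbel_max:
  fixes G :: "'a \<Rightarrow> real ^ 's::finite"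
  assumes "iid_standard_gumbel M G"
  shows "prob {\<omega> \<in> space M. strict_argmax (\<lambda>v. G \<omega> $ v + b v) u} = softmax b $ u"
proof -
  have ind: "indep_vars (\<lambda>_. borel) (\<lambda>u \<omega>. G \<omega> $ u) UNIV"
    and gum: "\<And>u. standard_gumbel M (\<lambda>\<omega>. G \<omega> $ u)"
    using assms by (auto simp: iid_standard_gumbel_def)
  define T where "T v \<omega> = exp (- (G \<omega> $ v + b v))" for v \<omega>
  have "prob {\<omega> \<in> space M. \<forall>v\<in>UNIV - {u}. T u \<omega> < T v \<omega>} = exp (b u) / (\<Sum>v\<in>UNIV. exp (b v))"
  proof (rule exponential_race)
    show "distributed M lborel (T v) (exponential_density (exp (b v)))" for v
      unfolding T_def by (rule standard_gumbel_exponential[OF gum])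
    show "indep_vars (\<lambda>_. borel) T UNIV"
      unfolding T_def by (rule indep_vars_compose2[OF ind]) auto
  qed auto
  moreover have "(\<forall>v\<in>UNIV - {u}. T u \<omega> < T v \<omega>) \<longleftrightarrow> strict_argmax (\<lambda>v. G \<omega> $ v + b v) u" for \<omega>
    unfolding T_def strict_argmax_def exp_less_cancel_iff neg_less_iff_less by blast
  ultimately show ?thesis
    by (simp add: softmax_def)
qed

text \<open>The winning events are disjoint and their probabilities, the entries of
  \<open>softmax b\<close>, sum to 1. Hence ties are null without any separate estimate.\<close>

lemma (in prob_space) gumbel_AE_strict_argmax:
  fixes G :: "'a \<Rightarrow> real ^ 's::finite"
  assumes G: "iid_standard_gumbel M G"
  shows "AE \<omega> in M. \<exists>u. strict_argmax (\<lambda>v. G \<omega> $ v + b v) u"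
proof -
  have [measurable]: "G \<in> borel_measurable M"
    using G by (simp add: iid_standard_gumbel_def)
  define A where "A u = {\<omega> \<in> space M. strict_argmax (\<lambda>v. G \<omega> $ v + b v) u}" for u
  have "disjoint_family A"
    by (auto simp: disjoint_family_on_def A_def dest: strict_argmax_unique)
  moreover have "A u \<in> events" for u
    unfolding A_def by measurable
  ultimately have "prob (\<Union>u\<in>UNIV. A u) = (\<Sum>u\<in>UNIV. prob (A u))"
    by (intro finite_measure_finite_Union) auto
  also have "\<dots> = 1"
    using softmax_simplex[of b] by (simp add: A_def gumbel_max[OF G] prob_simplex_def)
  finally show ?thesis
    by (rule AE_mp[OF AE_prob_1]) (auto simp: A_def)
qed

section \<open>Divergence and its tilt\<close>

text \<open>Termwise \<open>r * ln (r / p) \<ge> r - p\<close>, from \<open>ln x \<le> x - 1\<close>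
  at \<open>x = p / r\<close>; the right-hand sides sum to 0.\<close>

lemma KL_nonneg:
  assumes "r \<in> prob_simplex" "p \<in> prob_simplex" "\<And>u. 0 < p $ u"
  shows "0 \<le> KL r p"
proof -
  have "r $ u - p $ u \<le> r $ u * ln (r $ u / p $ u)" for u
  proof (cases "r $ u = 0")
    case False
    then have r: "0 < r $ u"
      using assms(1) by (simp add: prob_simplex_def order_less_le)
    have "ln (p $ u / r $ u) \<le> p $ u / r $ u - 1"
      using r assms(3)[of u] by (intro ln_le_minus_one) simp
    then have "r $ u * ln (p $ u / r $ u) \<le> p $ u - r $ u"
      using r by (simp add: field_simps)
    then show ?thesis
      using r assms(3)[of u] by (simp add: ln_div algebra_simps)
  qed (use assms(3)[of u] in simp)
  then have "(\<Sum>u\<in>UNIV. r $ u - p $ u) \<le> KL r p"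
    unfolding KL_def by (rule sum_mono)
  then show ?thesis
    using assms(1,2) by (simp add: prob_simplex_def sum_subtractf)
qed

lemma KL_self:
  assumes "\<And>u. 0 < p $ u"
  shows "KL p p = 0"
  using assms by (simp add: KL_def less_imp_neq[symmetric])

text \<open>Since \<open>ln p = (1 + \<delta>) * b\<close>, the linear term cancels all but one copy
  of \<open>b\<close>: \<open>\<delta> * b + ln (r / p) = ln r - b\<close>, which is
  \<open>ln (r / softmax b) - ln Z\<close> with \<open>Z\<close> the normalising sum. This is where
  the factor \<open>1 / (1 + \<delta>)\<close> comes from.\<close>

lemma tilted_KL:
  assumes r: "r \<in> prob_simplex" and p: "\<And>u. 0 < p $ u" and \<delta>: "0 < \<delta>"
    and b: "\<And>v. b v = 1 / (1 + \<delta>) * ln (p $ v)"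
  shows "(\<Sum>v\<in>UNIV. b v * r $ v) + 1 / \<delta> * KL r p
       = 1 / \<delta> * (KL r (softmax b) - ln (\<Sum>v\<in>UNIV. exp (b v)))"
proof -
  define Z where "Z = (\<Sum>v\<in>UNIV. exp (b v))"
  have Z: "0 < Z" unfolding Z_def by (rule sum_exp_pos)
  have "\<delta> * (b v * r $ v) + r $ v * ln (r $ v / p $ v)
      = r $ v * ln (r $ v / softmax b $ v) - r $ v * ln Z" for v
  proof (cases "r $ v = 0")
    case False
    then have rv: "0 < r $ v"
      using r by (simp add: prob_simplex_def order_less_le)
    have "ln (p $ v) = (1 + \<delta>) * b v"
      using \<delta> by (simp add: b)
    then have "ln (r $ v / p $ v) = ln (r $ v) - (1 + \<delta>) * b v"
      using rv p[of v] by (simp add: ln_div)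
    moreover have "ln (r $ v / softmax b $ v) = ln (r $ v) - b v + ln Z"
      using rv Z by (simp add: softmax_def Z_def[symmetric] ln_div ln_mult)
    ultimately show ?thesis by (simp only:) (simp add: algebra_simps)
  qed simp
  then have "(\<Sum>v\<in>UNIV. \<delta> * (b v * r $ v) + r $ v * ln (r $ v / p $ v))
      = (\<Sum>v\<in>UNIV. r $ v * ln (r $ v / softmax b $ v) - r $ v * ln Z)"
    by (simp only:)
  then have "\<delta> * (\<Sum>v\<in>UNIV. b v * r $ v) + KL r p = KL r (softmax b) - (\<Sum>v\<in>UNIV. r $ v) * ln Z"
    unfolding KL_def sum.distrib sum_subtractf sum_distrib_left sum_distrib_right .
  moreover have "(\<Sum>v\<in>UNIV. r $ v) = 1"
    using r by (simp add: prob_simplex_def)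
  ultimately have "\<delta> * (\<Sum>v\<in>UNIV. b v * r $ v) + KL r p = KL r (softmax b) - ln Z"
    by simp
  then show ?thesis
    using \<delta> unfolding Z_def[symmetric] by (metis add_divide_distrib divide_inverse_commute inverse_eq_divide nonzero_mult_div_cancel_left order_less_irrefl)
qed

section \<open>Simplex-valued maps and the tilted objective\<close>

lemma prob_simplexD:
  assumes "q \<in> prob_simplex"
  shows "0 \<le> q $ u" "q $ u \<le> 1" "(\<Sum>u\<in>UNIV. q $ u) = 1"
proof -
  show *: "0 \<le> q $ u" "(\<Sum>u\<in>UNIV. q $ u) = 1" for u
    using assms by (auto simp: prob_simplex_def)
  show "q $ u \<le> 1"
    using member_le_sum[of u UNIV "\<lambda>u. q $ u"] * by simp
qed

text \<open>The support is the whole space, so the restriction of the domain disappears.\<close>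

lemma (in prob_space) selection_maps_iff:
  fixes G :: "'a \<Rightarrow> real ^ 's::finite"
  assumes "iid_standard_gumbel M G"
  shows "q \<in> selection_maps M G \<longleftrightarrow> q \<in> borel_measurable borel \<and> (\<forall>x. q x \<in> prob_simplex)"
  by (auto simp: selection_maps_def law_support_gumbel[OF assms] measurable_restrict_space2_iff)

lemma (in prob_space) integrable_mult_simplex:
  fixes Y :: "'a \<Rightarrow> real ^ 's::finite"
  assumes "integrable M X" "Y \<in> borel_measurable M" "\<And>\<omega>. Y \<omega> \<in> prob_simplex"
  shows "integrable M (\<lambda>\<omega>. X \<omega> * Y \<omega> $ u)"
proof (rule Bochner_Integration.integrable_bound[OF assms(1)])
  show "(\<lambda>\<omega>. X \<omega> * Y \<omega> $ u) \<in> borel_measurable M"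
    using assms(1,2) by measurable
  show "AE \<omega> in M. norm (X \<omega> * Y \<omega> $ u) \<le> norm (X \<omega>)"
    using prob_simplexD(1,2)[OF assms(3)]
    by (intro AE_I2) (simp add: abs_mult mult_left_le)
qed

lemma (in prob_space) mean_vec_simplex:
  fixes Y :: "'a \<Rightarrow> real ^ 's::finite"
  assumes "Y \<in> borel_measurable M" "\<And>\<omega>. Y \<omega> \<in> prob_simplex"
  shows "mean_vec M Y \<in> prob_simplex"
proof -
  have "integrable M (\<lambda>\<omega>. Y \<omega> $ u)" for u
    using integrable_mult_simplex[OF _ assms, of "\<lambda>_. 1"] by simp
  then have "(\<Sum>u\<in>UNIV. \<integral>\<omega>. Y \<omega> $ u \<partial>M) = (\<integral>\<omega>. (\<Sum>u\<in>UNIV. Y \<omega> $ u) \<partial>M)"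
    by (subst Bochner_Integration.integral_sum) auto
  then show ?thesis
    using prob_simplexD[OF assms(2)]
    by (auto simp: prob_simplex_def mean_vec_def prob_space)
qed

text \<open>Adding \<open>b\<close> to \<open>G\<close> changes the expected reward by the inner
  product of \<open>b\<close> with the mean of \<open>q\<close>; \<open>tilted_KL\<close> absorbs
  this change into the divergence.\<close>

lemma (in prob_space) KL_objective_tilted:
  fixes G :: "'a \<Rightarrow> real ^ 's::finite"
  assumes G: "iid_standard_gumbel M G" and q: "q \<in> selection_maps M G"
    and p: "\<And>u. 0 < p $ u" and \<delta>: "0 < \<delta>"
    and b: "\<And>v. b v = 1 / (1 + \<delta>) * ln (p $ v)"
  shows "integrable M (\<lambda>\<omega>. \<Sum>v\<in>UNIV. (G \<omega> $ v + b v) * q (G \<omega>) $ v)"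
    and "KL_objective M G p \<delta> q = (\<integral>\<omega>. (\<Sum>v\<in>UNIV. (G \<omega> $ v + b v) * q (G \<omega>) $ v) \<partial>M)
      - 1 / \<delta> * (KL (mean_vec M (\<lambda>\<omega>. q (G \<omega>))) (softmax b) - ln (\<Sum>v\<in>UNIV. exp (b v)))"
proof -
  have [measurable]: "G \<in> borel_measurable M" "q \<in> borel_measurable borel"
    and qs: "\<And>x. q x \<in> prob_simplex"
    and gum: "\<And>u. standard_gumbel M (\<lambda>\<omega>. G \<omega> $ u)"
    using G q by (auto simp: iid_standard_gumbel_def selection_maps_iff[OF G])
  have int: "integrable M (\<lambda>\<omega>. X \<omega> * q (G \<omega>) $ v)" if "integrable M X" for X v
    by (rule integrable_mult_simplex[OF that _ qs]) simp
  have intG: "integrable M (\<lambda>\<omega>. G \<omega> $ v * q (G \<omega>) $ v)" for v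
    by (intro int standard_gumbel_integrable gum)
  have intb: "integrable M (\<lambda>\<omega>. b v * q (G \<omega>) $ v)" for v
    by (intro int) simp
  show "integrable M (\<lambda>\<omega>. \<Sum>v\<in>UNIV. (G \<omega> $ v + b v) * q (G \<omega>) $ v)"
    using intG intb by (simp add: distrib_right)
  have "(\<integral>\<omega>. (\<Sum>v\<in>UNIV. (G \<omega> $ v + b v) * q (G \<omega>) $ v) \<partial>M)
      = (\<integral>\<omega>. G \<omega> \<bullet> q (G \<omega>) \<partial>M) + (\<Sum>v\<in>UNIV. b v * mean_vec M (\<lambda>\<omega>. q (G \<omega>)) $ v)"
    using intG intb
    by (simp add: distrib_right sum.distrib inner_vec_def mean_vec_def
        Bochner_Integration.integral_sum)
  moreover have "mean_vec M (\<lambda>\<omega>. q (G \<omega>)) \<in> prob_simplex"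
    by (rule mean_vec_simplex) (auto simp: qs)
  note tilted_KL[OF this p \<delta> b]
  ultimately show "KL_objective M G p \<delta> q = (\<integral>\<omega>. (\<Sum>v\<in>UNIV. (G \<omega> $ v + b v) * q (G \<omega>) $ v) \<partial>M)
      - 1 / \<delta> * (KL (mean_vec M (\<lambda>\<omega>. q (G \<omega>))) (softmax b) - ln (\<Sum>v\<in>UNIV. exp (b v)))"
    unfolding KL_objective_def by linarith
qed

section \<open>The competitor: selecting the argmax\<close>

definition argmax_selector :: "('s::finite \<Rightarrow> real) \<Rightarrow> real ^ 's \<Rightarrow> real ^ 's \<Rightarrow> real ^ 's" where
  "argmax_selector b p x =
     (if \<exists>u. strict_argmax (\<lambda>v. x $ v + b v) u
      then \<chi> u. of_bool (strict_argmax (\<lambda>v. x $ v + b v) u) else p)"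

lemma argmax_selector_eq:
  assumes "strict_argmax (\<lambda>v. x $ v + b v) w"
  shows "argmax_selector b p x $ u = of_bool (u = w)"
proof -
  have "strict_argmax (\<lambda>v. x $ v + b v) u \<longleftrightarrow> u = w"
    using assms strict_argmax_unique by metis
  with assms show ?thesis by (auto simp: argmax_selector_def)
qed

lemma argmax_selector_simplex:
  assumes "p \<in> prob_simplex"
  shows "argmax_selector b p x \<in> prob_simplex"
proof (cases "\<exists>w. strict_argmax (\<lambda>v. x $ v + b v) w")
  case True
  then show ?thesis by (auto simp: prob_simplex_def argmax_selector_eq)
qed (use assms in \<open>simp add: argmax_selector_def\<close>)

lemma measurable_argmax_selector [measurable]:
  "argmax_selector b p \<in> borel_measurable borel"
proof -
  have [measurable]: "(\<lambda>x :: real ^ 's. \<chi> u. of_bool (strict_argmax (\<lambda>v. x $ v + b v) u) :: real ^ 's)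
      \<in> borel_measurable borel" for b :: "'s::finite \<Rightarrow> real"
    by (rule borel_measurable_vec_lambda) measurable
  show ?thesis
    unfolding argmax_selector_def by measurable
qed

text \<open>Almost surely coordinate \<open>u\<close> is the indicator that \<open>u\<close> wins,
  so its mean is the winning probability from \<open>gumbel_max\<close>.\<close>

lemma (in prob_space) mean_vec_argmax_selector:
  fixes G :: "'a \<Rightarrow> real ^ 's::finite"
  assumes G: "iid_standard_gumbel M G"
  shows "mean_vec M (\<lambda>\<omega>. argmax_selector b p (G \<omega>)) = softmax b"
proof -
  have [measurable]: "G \<in> borel_measurable M"
    using G by (simp add: iid_standard_gumbel_def)
  have "(\<integral>\<omega>. argmax_selector b p (G \<omega>) $ u \<partial>M) = softmax b $ u" for u
  proof -
    define A where "A = {\<omega> \<in> space M. strict_argmax (\<lambda>v. G \<omega> $ v + b v) u}"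
    have [measurable]: "A \<in> events" unfolding A_def by measurable
    have "AE \<omega> in M. argmax_selector b p (G \<omega>) $ u = indicator A \<omega>"
      using gumbel_AE_strict_argmax[OF G, of b] AE_space
    proof eventually_elim
      case (elim \<omega>)
      then show ?case
        by (auto simp: A_def argmax_selector_eq indicator_def dest: strict_argmax_unique)
    qed
    then have "(\<integral>\<omega>. argmax_selector b p (G \<omega>) $ u \<partial>M) = (\<integral>\<omega>. indicator A \<omega> \<partial>M)"
      by (intro integral_cong_AE) simp_all
    then show ?thesis
      by (simp add: A_def gumbel_max[OF G])
  qed
  then show ?thesis by (simp add: mean_vec_def vec_eq_iff)
qed

text \<open>Here \<open>f w - (\<Sum>v. f v * q $ v)\<close> is the \<open>q\<close>-average of the gaps \<open>f w - f v\<close>.\<close>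

lemma strict_argmax_average:
  assumes q: "q \<in> prob_simplex" and w: "strict_argmax f w"
  shows "(\<Sum>v\<in>UNIV. f v * q $ v) \<le> f w"
    and "(\<Sum>v\<in>UNIV. f v * q $ v) = f w \<Longrightarrow> q $ u = of_bool (u = w)"
proof -
  have gap: "f w - (\<Sum>v\<in>UNIV. f v * q $ v) = (\<Sum>v\<in>UNIV. (f w - f v) * q $ v)"
    by (simp add: left_diff_distrib sum_subtractf prob_simplexD(3)[OF q] flip: sum_distrib_left)
  have nonneg: "0 \<le> (f w - f v) * q $ v" for v
    using w prob_simplexD(1)[OF q] unfolding strict_argmax_def
    by (cases "v = w") (auto simp: less_imp_le)
  show "(\<Sum>v\<in>UNIV. f v * q $ v) \<le> f w"
    using gap sum_nonneg[of UNIV "\<lambda>v. (f w - f v) * q $ v"] nonneg by simp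
  assume "(\<Sum>v\<in>UNIV. f v * q $ v) = f w"
  \<comment> \<open>Nonnegative terms with sum 0 all vanish; off \<open>w\<close> the gap is
    positive, so \<open>q\<close> must vanish there and all the mass sits at
    \<open>w\<close>.\<close>
  then have "\<forall>v\<in>UNIV. (f w - f v) * q $ v = 0"
    using gap nonneg by (subst sum_nonneg_eq_0_iff[symmetric]) auto
  then have zero: "q $ v = 0" if "v \<noteq> w" for v
    using w that unfolding strict_argmax_def by (metis UNIV_I eq_iff_diff_eq_0 less_irrefl mult_eq_0_iff)
  have "(\<Sum>v\<in>UNIV. q $ v) = q $ w"
    by (subst sum.remove[of _ w]) (auto simp: zero)
  with zero prob_simplexD(3)[OF q] show "q $ u = of_bool (u = w)"
    by (cases "u = w") auto
qed

section \<open>Comparison of an optimal map with the argmax selector\<close>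

theorem theoremD4:
  fixes M :: "'w measure" and G :: "'w \<Rightarrow> real ^ 's::finite" and p :: "real ^ 's"
    and \<delta> :: real and qopt :: "real ^ 's \<Rightarrow> real ^ 's"
  assumes "prob_space M"
    and "iid_standard_gumbel M G"
    and "p \<in> prob_simplex" and "\<forall>u. p $ u > 0"
    and "\<delta> > 0"
    and "is_arg_max (KL_objective M G p \<delta>) (\<lambda>q. q \<in> selection_maps M G) qopt"
  shows "AE \<omega> in M. \<forall>u. qopt (G \<omega>) $ u =
           of_bool (is_arg_max (\<lambda>v. G \<omega> $ v + 1 / (1 + \<delta>) * ln (p $ v)) (\<lambda>v. True) u)"
proof -
  interpret prob_space M by fact
  note G = assms(2)
  define b where "b v = 1 / (1 + \<delta>) * ln (p $ v)" for v
  define qhat where "qhat = argmax_selector b p"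
  define S where "S q \<omega> = (\<Sum>v\<in>UNIV. (G \<omega> $ v + b v) * q (G \<omega>) $ v)" for q :: "real ^ 's \<Rightarrow> real ^ 's" and \<omega>
  have qopt: "qopt \<in> selection_maps M G"
    using assms(6) by (simp add: is_arg_max_def)
  then have simplex: "qopt x \<in> prob_simplex" for x
    by (simp add: selection_maps_iff[OF G])
  have qhat: "qhat \<in> selection_maps M G"
    unfolding qhat_def selection_maps_iff[OF G]
    using argmax_selector_simplex[OF assms(3)] by simp
  have int: "integrable M (S q)"
    and obj: "KL_objective M G p \<delta> q = (\<integral>\<omega>. S q \<omega> \<partial>M)
      - 1 / \<delta> * (KL (mean_vec M (\<lambda>\<omega>. q (G \<omega>))) (softmax b) - ln (\<Sum>v\<in>UNIV. exp (b v)))"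
    if "q \<in> selection_maps M G" for q
    using KL_objective_tilted[OF G that _ assms(5) b_def] assms(4) unfolding S_def by auto

  \<comment> \<open>The divergence from \<open>softmax b\<close> is nonnegative for
    \<open>qopt\<close> and zero for \<open>qhat\<close>, so optimality of \<open>qopt\<close> can
    only come from a tilted reward \<open>S\<close> that is at least as large on average.\<close>
  have "0 \<le> KL (mean_vec M (\<lambda>\<omega>. qopt (G \<omega>))) (softmax b)"
  proof (intro KL_nonneg softmax_simplex softmax_pos mean_vec_simplex simplex)
    show "(\<lambda>\<omega>. qopt (G \<omega>)) \<in> borel_measurable M"
      using G qopt by (auto simp: iid_standard_gumbel_def selection_maps_iff[OF G])
  qed
  moreover have "KL (mean_vec M (\<lambda>\<omega>. qhat (G \<omega>))) (softmax b) = 0"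
    unfolding qhat_def mean_vec_argmax_selector[OF G] by (rule KL_self[OF softmax_pos])
  moreover have "KL_objective M G p \<delta> qhat \<le> KL_objective M G p \<delta> qopt"
    using assms(6) qhat by (auto simp: is_arg_max_def not_less)
  ultimately have "(\<integral>\<omega>. S qhat \<omega> \<partial>M) \<le> (\<integral>\<omega>. S qopt \<omega> \<partial>M)"
    using assms(5) obj[OF qopt] obj[OF qhat] by (simp add: right_diff_distrib) (smt (verit) divide_nonneg_pos)
  then have le: "(\<integral>\<omega>. S qhat \<omega> - S qopt \<omega> \<partial>M) \<le> 0"
    using int qopt qhat by simp

  have S_qhat: "S qhat \<omega> = G \<omega> $ w + b w"
    if "strict_argmax (\<lambda>v. G \<omega> $ v + b v) w" for \<omega> w
    unfolding S_def qhat_def by (simp add: argmax_selector_eq[OF that])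
  note ae = gumbel_AE_strict_argmax[OF G, of b]
  \<comment> \<open>Pointwise the opposite holds: the maximum of \<open>G + b\<close> dominates each
    of its averages. A nonnegative difference with nonpositive mean then vanishes almost
    surely.\<close>
  have nonneg: "AE \<omega> in M. 0 \<le> S qhat \<omega> - S qopt \<omega>"
    using ae
  proof eventually_elim
    case (elim \<omega>)
    then obtain w where w: "strict_argmax (\<lambda>v. G \<omega> $ v + b v) w" ..
    show ?case
      using strict_argmax_average(1)[OF simplex w] S_qhat[OF w] by (simp add: S_def)
  qed
  then have "(\<integral>\<omega>. S qhat \<omega> - S qopt \<omega> \<partial>M) = 0"
    using le integral_nonneg_AE[OF nonneg] by linarith
  then have "AE \<omega> in M. S qhat \<omega> - S qopt \<omega> = 0"
    using int qopt qhat by (subst integral_nonneg_eq_0_iff_AE[symmetric, OF _ nonneg]) auto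
  with ae show ?thesis
  proof eventually_elim
    case (elim \<omega>)
    then obtain w where w: "strict_argmax (\<lambda>v. G \<omega> $ v + b v) w" by blast
    then have "(\<Sum>v\<in>UNIV. (G \<omega> $ v + b v) * qopt (G \<omega>) $ v) = G \<omega> $ w + b w"
      using elim S_qhat[OF w] by (simp add: S_def)
    \<comment> \<open>An average equal to a strict maximum puts all its weight on the
      maximiser.\<close>
    from strict_argmax_average(2)[OF simplex w this]
    show ?case
      using is_arg_max_iff_strict_argmax[OF w] by (simp add: b_def)
  qed
qed

end
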